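(* Let $f=\sum_{i=0}^\infty a_i z^i\in \mathbb{Z}[[z]]$ be such that $a_0=\pm p^k$ for some positive integer $k$ and a prime $p$. Suppose there exists an index $j\geq 1$ for which $p$ does not divide $a_j$. Then $f$ is a product of at most $\min\{k,j\}$ irreducible factors in $\mathbb{Z}[[z]]$. In particular, if $k=1$ or $j=1$, then $f$ is irreducible in $\mathbb{Z}[[z]]$.
   Context: $\mathbb{Z}[[z]]$ denotes the ring of formal power series in $z$ over $\mathbb{Z}$; it is a unique factorization domain, and irreducible factors are counted with multiplicity. *)

theory Defs
  imports "HOL-Computational_Algebra.Computational_Algebra"
begin

end

theory Submission
  imports Defs
begin

text \<open>
  A power series over \<open>\<int>\<close> is a unit iff its constant term is. Hence, if the constant term of
  \<open>f\<close> is \<open>\<plusminus>p ^ k\<close>, every non-unit factor of \<open>f\<close> has a constant term divisible by \<open>p\<close>; in other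
  words it lies in the ideal \<open>(p, z)\<close>. A product of \<open>n\<close> such factors lies in \<open>(p, z) ^ n\<close>,
  which says that its coefficient of \<open>z ^ i\<close> is divisible by \<open>p ^ (n - i)\<close>
  (\<open>power_dvd_fps_nth_prod_mset\<close>). The coefficient of \<open>z ^ 0\<close> gives \<open>n \<le> k\<close>, and the
  coefficient of \<open>z ^ j\<close>, which \<open>p\<close> does not divide, gives \<open>n \<le> j\<close>.

  This bounds the length of every factorization into irreducibles. That one exists follows by
  descent on the absolute value of the constant term, which drops strictly when a non-unit is
  split off (\<open>int_fps_irreducible_factorization_exists\<close>). If \<open>min k j = 1\<close>, that
  factorization has a single factor, which is \<open>f\<close> itself.
\<close>

lemma fps_dvd_1_iff:
  fixes f :: "'a :: comm_ring_1 fps"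
  shows "f dvd 1 \<longleftrightarrow> fps_nth f 0 dvd 1"
proof
  assume "f dvd 1"
  then obtain g where "1 = f * g" by (rule dvdE)
  then have "fps_nth f 0 * fps_nth g 0 = 1"
    by (metis fps_mult_nth_0 fps_one_nth)
  then show "fps_nth f 0 dvd 1" by (metis dvd_triv_left)
next
  assume "fps_nth f 0 dvd 1"
  then obtain y where "fps_nth f 0 * y = 1" by (metis dvdE)
  then have "f * fps_right_inverse f y = 1" by (rule fps_right_inverse)
  then show "f dvd 1" by (metis dvd_triv_left)
qed

text \<open>
  The series in the ideal \<open>(p, z) ^ n\<close> are those whose \<open>i\<close>-th coefficient is divisible by
  \<open>p ^ (n - i)\<close> for all \<open>i\<close>, the exponent being truncated at \<open>0\<close>. Multiplying by a further
  element \<open>q\<close> of \<open>(p, z)\<close> gains one power of \<open>p\<close> in the coefficients of index at most \<open>n\<close>: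
  the constant term of \<open>q\<close> contributes \<open>p\<close> itself, and its higher terms meet coefficients of smaller index.
\<close>

lemma power_dvd_fps_nth_prod_mset:
  fixes A :: "'a :: comm_ring_1 fps multiset"
  assumes "\<And>q. q \<in># A \<Longrightarrow> p dvd fps_nth q 0"
  shows "p ^ (size A - i) dvd fps_nth (prod_mset A) i"
  using assms
proof (induction A arbitrary: i)
  case empty
  then show ?case by simp
next
  case (add q A)
  have IH: "p ^ (size A - i) dvd fps_nth (prod_mset A) i" for i
    using add by simp
  have "p ^ (Suc (size A) - i) dvd fps_nth q l * fps_nth (prod_mset A) (i - l)" if "l \<le> i" for l
  proof (cases l)
    case 0
    have "p * p ^ (size A - i) dvd fps_nth q 0 * fps_nth (prod_mset A) i"
      using add.prems IH by (intro mult_dvd_mono) auto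
    moreover have "p ^ (Suc (size A) - i) dvd p ^ Suc (size A - i)"
      by (rule le_imp_power_dvd) simp
    ultimately show ?thesis using 0 by (auto intro: dvd_trans)
  next
    case (Suc m)
    have "p ^ (Suc (size A) - i) dvd p ^ (size A - (i - l))"
      using Suc that by (intro le_imp_power_dvd) linarith
    then show ?thesis using IH[of "i - l"] by (meson dvd_mult dvd_trans)
  qed
  then show ?case by (auto simp: fps_mult_nth intro!: dvd_sum)
qed

lemma int_fps_irreducible_factorization_exists:
  fixes f :: "int fps"
  assumes "fps_nth f 0 \<noteq> 0" and "\<not> f dvd 1"
  shows "\<exists>A. (\<forall>q \<in># A. irreducible q) \<and> f = prod_mset A"
  using assms
proof (induction "nat \<bar>fps_nth f 0\<bar>" arbitrary: f rule: less_induct)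
  case less
  show ?case
  proof (cases "irreducible f")
    case True
    then show ?thesis by (intro exI[of _ "{#f#}"]) simp
  next
    case False
    moreover have "f \<noteq> 0" using less.prems by auto
    ultimately obtain a b where ab: "f = a * b" "\<not> a dvd 1" "\<not> b dvd 1"
      using less.prems unfolding irreducible_def by blast
    have nth0: "fps_nth f 0 = fps_nth a 0 * fps_nth b 0" by (simp add: ab)
    then have nz: "fps_nth a 0 \<noteq> 0" "fps_nth b 0 \<noteq> 0" using less.prems by auto
    have "\<bar>fps_nth a 0\<bar> > 1" "\<bar>fps_nth b 0\<bar> > 1"
      using nz ab by (auto simp: fps_dvd_1_iff)
    then have "\<bar>fps_nth a 0\<bar> < \<bar>fps_nth f 0\<bar>" "\<bar>fps_nth b 0\<bar> < \<bar>fps_nth f 0\<bar>"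
      using nz by (simp_all add: nth0 abs_mult mult_less_cancel_left1 mult_less_cancel_right1)
    then have "nat \<bar>fps_nth a 0\<bar> < nat \<bar>fps_nth f 0\<bar>" "nat \<bar>fps_nth b 0\<bar> < nat \<bar>fps_nth f 0\<bar>"
      by linarith+
    then obtain A B where "\<forall>q \<in># A. irreducible q" "a = prod_mset A"
        "\<forall>q \<in># B. irreducible q" "b = prod_mset B"
      using less.hyps nz ab by meson
    then show ?thesis using ab by (intro exI[of _ "A + B"]) auto
  qed
qed

lemma prime_dvd_nonunit_dvd_power:
  fixes p :: "'a :: factorial_semiring"
  assumes "prime p" and "c dvd p ^ k" and "\<not> c dvd 1"
  shows "p dvd c"
proof -
  have "c \<noteq> 0" using assms by (metis dvd_0_left_iff not_prime_0 power_not_zero)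
  then obtain r where r: "prime r" "r dvd c"
    using assms prime_divisor_exists by blast
  then have "r dvd p" using assms by (meson dvd_trans prime_dvd_power)
  then have "r = p" using r assms by (simp add: primes_dvd_imp_eq)
  then show ?thesis using r by simp
qed

theorem theorem3:
  fixes f :: "int fps" and p :: int and k j :: nat
  assumes "prime p" and "k > 0"
    and "fps_nth f 0 = p ^ k \<or> fps_nth f 0 = - (p ^ k)"
    and "j \<ge> 1" and "\<not> p dvd fps_nth f j"
  shows "(\<exists>A. (\<forall>q \<in># A. irreducible q) \<and> f = prod_mset A \<and> size A \<le> min k j) \<and>
         (\<forall>A. (\<forall>q \<in># A. irreducible q) \<and> f = prod_mset A \<longrightarrow> size A \<le> min k j) \<and>
         (k = 1 \<or> j = 1 \<longrightarrow> irreducible f)"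
proof -
  have dvd_nth0: "c dvd fps_nth f 0 \<longleftrightarrow> c dvd p ^ k" for c
    using assms(3) by auto
  have p: "p \<noteq> 0" "\<not> p dvd 1" using assms(1) by auto
  have nz: "fps_nth f 0 \<noteq> 0" using assms(3) p by auto
  have "p dvd fps_nth f 0" using assms(2) by (simp add: dvd_nth0 dvd_power)
  then have nonunit: "\<not> f dvd 1" using p by (meson dvd_trans fps_dvd_1_iff)
  have bound: "size A \<le> min k j"
    if A: "\<forall>q \<in># A. irreducible q" "f = prod_mset A" for A
  proof -
    have p_dvd: "p dvd fps_nth q 0" if "q \<in># A" for q
    proof (rule prime_dvd_nonunit_dvd_power[OF assms(1)])
      have "q dvd f" using that A by (simp add: dvd_prod_mset)
      then have "fps_nth q 0 dvd fps_nth f 0" by (auto elim!: dvdE)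
      then show "fps_nth q 0 dvd p ^ k" by (simp add: dvd_nth0)
      show "\<not> fps_nth q 0 dvd 1"
        using that A fps_dvd_1_iff irreducible_not_unit by blast
    qed
    have dvd: "p ^ (size A - i) dvd fps_nth f i" for i
      using power_dvd_fps_nth_prod_mset p_dvd A(2) by blast
    have "size A \<le> k"
      using dvd[of 0] p by (simp add: dvd_nth0 dvd_power_iff)
    moreover have "size A \<le> j"
    proof (rule ccontr)
      assume "\<not> size A \<le> j"
      then have "p dvd p ^ (size A - j)" by (simp add: dvd_power)
      then show False using dvd[of j] assms(5) dvd_trans by blast
    qed
    ultimately show ?thesis by simp
  qed
  obtain A where A: "\<forall>q \<in># A. irreducible q" "f = prod_mset A"
    using int_fps_irreducible_factorization_exists[OF nz nonunit] by blast
  have "irreducible f" if "k = 1 \<or> j = 1"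
  proof -
    have "size A \<le> 1" using bound[OF A] that by auto
    moreover have "A \<noteq> {#}" using A nonunit by auto
    ultimately have "size A = 1" by (simp add: le_Suc_eq)
    then obtain q where "A = {#q#}" by (metis One_nat_def size_1_singleton_mset)
    then show ?thesis using A by simp
  qed
  then show ?thesis using A bound by blast
qed

end
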